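(* Let $X$ be a Hausdorff sequentially complete locally convex space over $\mathbb{C}$, let $C\in L(X)$, let $\mathcal{A}$ be a multivalued linear operator (MLO) in $X$ with $C\mathcal{A}\subseteq \mathcal{A}C$, let $\lambda\in\mathbb{C}\setminus\{0\}$, and suppose that $\lambda^{-1}\in\rho_{C}(\mathcal{A})$. Then $\lambda\in\rho_{C}(\mathcal{A}^{-1})$ and $$ \bigl(\lambda-\mathcal{A}^{-1}\bigr)^{-1}C=\lambda^{-1}\Bigl[C-\lambda^{-1}\bigl(\lambda^{-1}-\mathcal{A}\bigr)^{-1}C\Bigr]. $$
   Context: $L(X)$ is the space of continuous linear operators on $X$; $C$ is not assumed injective. A map $\mathcal{A}:X\to P(X)$ is a multivalued linear operator (MLO) in $X$ if $D(\mathcal{A}):=\{x:\mathcal{A}x\neq\emptyset\}$ is a linear subspace, $\mathcal{A}x+\mathcal{A}y\subseteq\mathcal{A}(x+y)$ for $x,y\in D(\mathcal{A})$ and $\lambda\mathcal{A}x\subseteq\mathcal{A}(\lambda x)$ for $\lambda\in\mathbb{C}$, $x\in D(\mathcal{A})$. It is identified with its graph $\{(x,y): y\in\mathcal{A}x\}\subseteq X\times X$ (a linear subspace), and inclusions of MLOs are inclusions of graphs. $R(\cdot)$ denotes the range. Sums and products of MLOs are defined as usual for linear relations. The inverse is $\mathcal{A}^{-1}=\{(y,x):(x,y)\in\mathcal{A}\}$, again an MLO. The $C$-resolvent set $\rho_{C}(\mathcal{A})$ is the set of all $\lambda\in\mathbb{C}$ such that $R(C)\subseteq R(\lambda-\mathcal{A})$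 and $(\lambda-\mathcal{A})^{-1}C$ is a single-valued continuous linear operator on $X$. *)

theory Defs
  imports "HOL-Analysis.Analysis"
begin

class scaleC =
  fixes scaleC :: "complex \<Rightarrow> 'a \<Rightarrow> 'a"  (infixr "*\<^sub>C" 75)

(* Hausdorff sequentially complete locally convex spaces over the complex numbers.
   The vector space laws not listed, Hausdorffness and continuity of addition and negation
   come from the superclasses. Class axioms cannot mention convex or continuous_on (on pairs)
   at the class type; so convexity is written out, and joint continuity of scalar
   multiplication is stated as in tendsto_add_Pair. *)
class complex_sclcs = scaleC + topological_ab_group_add + t2_space +
  assumes scaleC_add_right: "a *\<^sub>C (x + y) = a *\<^sub>C x + a *\<^sub>C y"
    and scaleC_add_left: "(a + b) *\<^sub>C x = a *\<^sub>C x + b *\<^sub>C x"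
    and scaleC_scaleC: "a *\<^sub>C b *\<^sub>C x = (a * b) *\<^sub>C x"
    and scaleC_one: "1 *\<^sub>C x = x"
    and tendsto_scaleC_Pair: "LIM p (nhds a \<times>\<^sub>F nhds x). fst p *\<^sub>C snd p :> nhds (a *\<^sub>C x)"
    and locally_convex: "open U \<Longrightarrow> 0 \<in> U \<Longrightarrow> \<exists>V. open V \<and> 0 \<in> V \<and> V \<subseteq> U \<and>
          (\<forall>x\<in>V. \<forall>y\<in>V. \<forall>u\<ge>0. \<forall>v\<ge>0. u + v = 1 \<longrightarrow> complex_of_real u *\<^sub>C x + complex_of_real v *\<^sub>C y \<in> V)"
    and sequentially_complete:
      "(\<And>U. open U \<Longrightarrow> 0 \<in> U \<Longrightarrow> \<exists>N::nat. \<forall>m\<ge>N. \<forall>n\<ge>N. s m - s n \<in> U) \<Longrightarrow> \<exists>l. s \<longlonglongrightarrow> l"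

interpretation complex_sclcs: vector_space "scaleC :: complex \<Rightarrow> 'a \<Rightarrow> 'a::complex_sclcs"
  by unfold_locales (simp_all add: scaleC_add_right scaleC_add_left scaleC_scaleC scaleC_one)

(* L(X) *)
definition continuous_linear_op :: "('a::complex_sclcs \<Rightarrow> 'a) \<Rightarrow> bool" where
  "continuous_linear_op T \<longleftrightarrow> Vector_Spaces.linear scaleC scaleC T \<and> continuous_on UNIV T"

(* A multivalued operator is given by its graph: the value of A at x is A `` {x},
   its domain, range and inverse are Domain A, Range A and A\<inverse>. *)
definition is_MLO :: "'a::complex_sclcs rel \<Rightarrow> bool" where
  "is_MLO A \<longleftrightarrow>
     complex_sclcs.subspace (Domain A) \<and>
     (\<forall>x\<in>Domain A. \<forall>y\<in>Domain A. {u + v |u v. u \<in> A `` {x} \<and> v \<in> A `` {y}} \<subseteq> A `` {x + y}) \<and>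
     (\<forall>c. \<forall>x\<in>Domain A. {c *\<^sub>C u |u. u \<in> A `` {x}} \<subseteq> A `` {c *\<^sub>C x})"

definition op_graph :: "('a \<Rightarrow> 'a) \<Rightarrow> 'a rel" where
  "op_graph T = {(x, T x) |x. True}"

(* The product B A of linear relations applies A first, whereas O composes from left to right. *)
abbreviation MLO_comp :: "'a rel \<Rightarrow> 'a rel \<Rightarrow> 'a rel"  (infixr "\<circ>\<^sub>M" 75) where
  "B \<circ>\<^sub>M A \<equiv> A O B"

definition MLO_scale :: "complex \<Rightarrow> 'a::complex_sclcs rel \<Rightarrow> 'a rel"  (infixr "*\<^sub>M" 75) where
  "c *\<^sub>M A = {(x, c *\<^sub>C y) |x y. (x, y) \<in> A}"

definition MLO_plus :: "'a::complex_sclcs rel \<Rightarrow> 'a rel \<Rightarrow> 'a rel"  (infixl "+\<^sub>M" 65) where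
  "A +\<^sub>M B = {(x, y + z) |x y z. (x, y) \<in> A \<and> (x, z) \<in> B}"

(* This is not set difference of graphs. *)
definition MLO_minus :: "'a::complex_sclcs rel \<Rightarrow> 'a rel \<Rightarrow> 'a rel"  (infixl "-\<^sub>M" 65) where
  "A -\<^sub>M B = A +\<^sub>M (- 1) *\<^sub>M B"

definition scalar_op :: "complex \<Rightarrow> 'a::complex_sclcs rel" where
  "scalar_op c = c *\<^sub>M Id"

definition C_resolvent_set :: "('a::complex_sclcs \<Rightarrow> 'a) \<Rightarrow> 'a rel \<Rightarrow> complex set" where
  "C_resolvent_set C A =
     {l. range C \<subseteq> Range (scalar_op l -\<^sub>M A) \<and>
         (\<exists>T. continuous_linear_op T \<and> (scalar_op l -\<^sub>M A)\<inverse> \<circ>\<^sub>M op_graph C = op_graph T)}"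

end

theory Submission
  imports Defs
begin

text \<open>For \<open>z = l *\<^sub>C (C x - l *\<^sub>C w)\<close> one has
  \<open>(l *\<^sub>C w - C x, w) = (- inverse l) *\<^sub>C (z, inverse l *\<^sub>C z - C x)\<close>. As graphs of MLOs are closed under
  scalars, \<open>w \<in> (l - A\<inverse>)\<inverse> C x\<close> is therefore equivalent to \<open>z \<in> (inverse l - A)\<inverse> C x\<close>.\<close>

text \<open>With the next lemma, this collapses the right-hand side of the theorem to the graph of a
  single function.\<close>

lemma MLO_scale_op_graph: "c *\<^sub>M op_graph T = op_graph (\<lambda>x. c *\<^sub>C T x)"
  by (auto simp: MLO_scale_def op_graph_def)

lemma MLO_minus_op_graph: "op_graph S -\<^sub>M op_graph T = op_graph (\<lambda>x. S x - T x)"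
  by (auto simp: MLO_minus_def MLO_plus_def MLO_scale_op_graph)
     (auto simp: op_graph_def)

lemma is_MLO_scaleC: "is_MLO A \<Longrightarrow> (x, y) \<in> A \<Longrightarrow> (c *\<^sub>C x, c *\<^sub>C y) \<in> A"
  unfolding is_MLO_def by blast

lemma is_MLO_scaleC_iff:
  assumes "is_MLO A" "c \<noteq> 0"
  shows "(c *\<^sub>C x, c *\<^sub>C y) \<in> A \<longleftrightarrow> (x, y) \<in> A"
  using is_MLO_scaleC[OF assms(1), of "c *\<^sub>C x" "c *\<^sub>C y" "inverse c"]
    is_MLO_scaleC[OF assms(1)] assms(2) by auto

text \<open>The intermediate value \<open>y\<close> with \<open>(w, y) \<in> A\<close> is determined
  by \<open>C x = c *\<^sub>C w - y\<close>. Inverse, sum and product of relations thus reduce to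
  one membership, for an arbitrary relation \<open>A\<close>.\<close>

lemma mem_resolvent_comp_iff:
  "(x, w) \<in> (scalar_op c -\<^sub>M A)\<inverse> \<circ>\<^sub>M op_graph C \<longleftrightarrow> (w, c *\<^sub>C w - C x) \<in> A"
proof -
  have "(x, w) \<in> (scalar_op c -\<^sub>M A)\<inverse> \<circ>\<^sub>M op_graph C \<longleftrightarrow> (\<exists>y. (w, y) \<in> A \<and> C x = c *\<^sub>C w - y)"
    by (auto simp: relcomp_unfold op_graph_def MLO_minus_def MLO_plus_def MLO_scale_def scalar_op_def)
  also have "\<dots> \<longleftrightarrow> (w, c *\<^sub>C w - C x) \<in> A"
    by (metis add_diff_cancel_left' diff_add_cancel)
  finally show ?thesis .
qed

text \<open>Neither side is assumed single-valued, so this can be used to prove that the left-hand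
  relation is the graph of a function.\<close>

lemma resolvent_converse_iff:
  assumes "is_MLO A" "l \<noteq> 0"
  shows "(x, w) \<in> (scalar_op l -\<^sub>M A\<inverse>)\<inverse> \<circ>\<^sub>M op_graph C \<longleftrightarrow>
    (x, l *\<^sub>C (C x - l *\<^sub>C w)) \<in> (scalar_op (inverse l) -\<^sub>M A)\<inverse> \<circ>\<^sub>M op_graph C"
proof -
  let ?z = "l *\<^sub>C (C x - l *\<^sub>C w)"
  have "(x, w) \<in> (scalar_op l -\<^sub>M A\<inverse>)\<inverse> \<circ>\<^sub>M op_graph C \<longleftrightarrow> (l *\<^sub>C w - C x, w) \<in> A"
    unfolding mem_resolvent_comp_iff by simp
  \<comment> \<open>The rule \<open>scale_minus_left\<close> would pull the sign out of
    \<open>- l\<close> and hide the common scalar that \<open>is_MLO_scaleC_iff\<close> has to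
    match.\<close>
  also have "\<dots> \<longleftrightarrow> ((- l) *\<^sub>C (l *\<^sub>C w - C x), (- l) *\<^sub>C w) \<in> A"
    using assms by (simp add: is_MLO_scaleC_iff del: complex_sclcs.scale_minus_left)
  also have "(- l) *\<^sub>C (l *\<^sub>C w - C x) = ?z"
    by (simp add: complex_sclcs.scale_right_diff_distrib)
  also have "(- l) *\<^sub>C w = inverse l *\<^sub>C ?z - C x"
    using assms by simp
  finally show ?thesis
    unfolding mem_resolvent_comp_iff .
qed

text \<open>Joint continuity of scalar multiplication is composed with
  \<open>\<lambda>y. (c, y)\<close>.\<close>

lemma continuous_on_scaleC: "continuous_on UNIV ((*\<^sub>C) c :: 'a \<Rightarrow> 'a::complex_sclcs)"
proof -
  have "((*\<^sub>C) c \<longlongrightarrow> c *\<^sub>C x) (at x)" for x :: 'a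
  proof -
    have "LIM y (at x). (c, y) :> nhds c \<times>\<^sub>F nhds x"
      by (intro filterlim_Pair tendsto_const tendsto_ident_at)
    from filterlim_compose[OF tendsto_scaleC_Pair this] show ?thesis
      by simp
  qed
  then show ?thesis
    by (simp add: continuous_on_def)
qed

lemma continuous_linear_op_scaleC:
  assumes "continuous_linear_op T"
  shows "continuous_linear_op (\<lambda>x. c *\<^sub>C T x)"
proof -
  interpret T: Vector_Spaces.linear scaleC scaleC T
    using assms by (simp add: continuous_linear_op_def)
  have "Vector_Spaces.linear scaleC scaleC (\<lambda>x. c *\<^sub>C T x)"
    by unfold_locales
      (simp_all add: T.add T.scale complex_sclcs.scale_right_distrib mult.commute)
  then show ?thesis
    using assms continuous_on_compose2[OF continuous_on_scaleC, of UNIV T c]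
    by (simp add: continuous_linear_op_def)
qed

lemma continuous_linear_op_diff:
  assumes "continuous_linear_op S" "continuous_linear_op T"
  shows "continuous_linear_op (\<lambda>x. S x - T x)"
proof -
  interpret S: Vector_Spaces.linear scaleC scaleC S
    using assms by (simp add: continuous_linear_op_def)
  interpret T: Vector_Spaces.linear scaleC scaleC T
    using assms by (simp add: continuous_linear_op_def)
  have "Vector_Spaces.linear scaleC scaleC (\<lambda>x. S x - T x)"
    by unfold_locales
      (simp_all add: S.add S.scale T.add T.scale complex_sclcs.scale_right_diff_distrib)
  \<comment> \<open>The difference is written as a sum with a negative, to match the continuity of
    addition and negation.\<close>
  moreover have "continuous_on UNIV (\<lambda>x. S x + - T x)"
    using assms unfolding continuous_linear_op_def continuous_on_def
    by (intro ballI tendsto_add tendsto_minus) auto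
  ultimately show ?thesis
    by (simp add: continuous_linear_op_def)
qed

text \<open>The range inclusion is automatic: \<open>op_graph T\<close> is total, so each
  \<open>C x\<close> lies in the domain of the inverse relation.\<close>

lemma C_resolvent_setI:
  assumes "continuous_linear_op T" "(scalar_op l -\<^sub>M A)\<inverse> \<circ>\<^sub>M op_graph C = op_graph T"
  shows "l \<in> C_resolvent_set C A"
proof -
  have "C x \<in> Range (scalar_op l -\<^sub>M A)" for x
  proof -
    have "(x, T x) \<in> (scalar_op l -\<^sub>M A)\<inverse> \<circ>\<^sub>M op_graph C"
      unfolding assms(2) by (simp add: op_graph_def)
    then show ?thesis
      by (auto simp: op_graph_def)
  qed
  with assms show ?thesis
    by (auto simp: C_resolvent_set_def)
qed

theorem proposition1p1:
  fixes C :: "'a::complex_sclcs \<Rightarrow> 'a" and A :: "'a rel" and l :: complex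
  assumes "continuous_linear_op C"
    and "is_MLO A"
    and "op_graph C \<circ>\<^sub>M A \<subseteq> A \<circ>\<^sub>M op_graph C"
    and "l \<noteq> 0"
    and "inverse l \<in> C_resolvent_set C A"
  shows "l \<in> C_resolvent_set C (A\<inverse>) \<and>
    (scalar_op l -\<^sub>M A\<inverse>)\<inverse> \<circ>\<^sub>M op_graph C =
      inverse l *\<^sub>M (op_graph C -\<^sub>M inverse l *\<^sub>M ((scalar_op (inverse l) -\<^sub>M A)\<inverse> \<circ>\<^sub>M op_graph C))"
proof -
  from assms(5) obtain T where T: "continuous_linear_op T"
    and graph_T: "(scalar_op (inverse l) -\<^sub>M A)\<inverse> \<circ>\<^sub>M op_graph C = op_graph T"
    by (auto simp: C_resolvent_set_def)
  \<comment> \<open>\<open>S x\<close> is the solution \<open>w\<close> of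
    \<open>l *\<^sub>C (C x - l *\<^sub>C w) = T x\<close>.\<close>
  define S where "S = (\<lambda>x. inverse l *\<^sub>C (C x - inverse l *\<^sub>C T x))"
  have "(x, w) \<in> (scalar_op l -\<^sub>M A\<inverse>)\<inverse> \<circ>\<^sub>M op_graph C \<longleftrightarrow> (x, w) \<in> op_graph S" for x w
  proof -
    \<comment> \<open>This equation has exactly one solution \<open>w\<close> since
      \<open>l \<noteq> 0\<close>, so totality and single-valuedness pass from \<open>T\<close> to
      the new relation.\<close>
    have "(x, w) \<in> (scalar_op l -\<^sub>M A\<inverse>)\<inverse> \<circ>\<^sub>M op_graph C \<longleftrightarrow> l *\<^sub>C (C x - l *\<^sub>C w) = T x"
      unfolding resolvent_converse_iff[OF assms(2,4)] graph_T by (auto simp: op_graph_def)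
    also have "\<dots> \<longleftrightarrow> C x - l *\<^sub>C w = inverse l *\<^sub>C T x"
      using assms(4) by (metis left_inverse right_inverse scaleC_one scaleC_scaleC)
    also have "\<dots> \<longleftrightarrow> l *\<^sub>C w = C x - inverse l *\<^sub>C T x"
      by (auto simp: algebra_simps)
    also have "\<dots> \<longleftrightarrow> w = S x"
      unfolding S_def using assms(4) by (metis left_inverse right_inverse scaleC_one scaleC_scaleC)
    finally show ?thesis
      by (simp add: op_graph_def)
  qed
  then have graph_S: "(scalar_op l -\<^sub>M A\<inverse>)\<inverse> \<circ>\<^sub>M op_graph C = op_graph S"
    by (intro set_eqI) (auto simp only: split_paired_all)
  have "continuous_linear_op S"
    unfolding S_def by (intro continuous_linear_op_scaleC continuous_linear_op_diff assms(1) T)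
  from C_resolvent_setI[OF this graph_S] show ?thesis
    by (simp add: graph_S graph_T MLO_scale_op_graph MLO_minus_op_graph S_def)
qed

end
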